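(* Let $m\ge1$, $n_1,\dots,n_m$ positive integers, and $k_1<\dots<k_m$ positive integers with $k_1\le n_1$, $k_i<k_{i-1}+n_i$ for $1<i<m$, and $k_m\le k_{m-1}+n_m$ (the case $k_m=k_{m-1}+n_m$ encoding that level $m$ consists of dummies). Let $G=H_\exists(\mathbf n,\mathbf k)$. Then $G$ is a weighted majority game if and only if one of the following holds: (1) $m=1$; (2) $m=2$ and $k_2=k_1+1$; (3) $m=2$ and $n_2=k_2-k_1+1$; (4) $k_1=1$ and either $m=2$, or $m=3$ and the game $H_\exists((n_2,n_3),(k_2,k_3))$ falls under (2) or (3), i.e. $k_3=k_2+1$ or $n_3=k_3-k_2+1$; (5) $m\in\{2,3,4\}$, $k_m\ge k_{m-1}+n_m$, and the parameters $\mathbf n'=(n_1,\dots,n_{m-1})$, $\mathbf k'=(k_1,\dots,k_{m-1})$ of the $(m-1)$-level game $H_\exists(\mathbf n',\mathbf k')$ satisfy one of (1)–(4) (with $m-1$ in place of $m$).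
   Context: Submultisets of $\{1^{n_1},\dots,m^{n_m}\}$ are written $\{1^{\ell_1},\dots,m^{\ell_m}\}$ with $0\le\ell_i\le n_i$. The disjunctive hierarchical game $H_\exists(\mathbf n,\mathbf k)$, $\mathbf n=(n_1,\dots,n_m)$, $\mathbf k=(k_1,\dots,k_m)$, is the simple game on the multiset $\{1^{n_1},\dots,m^{n_m}\}$ in which $\{1^{\ell_1},\dots,m^{\ell_m}\}$ is winning iff there exists $i$ with $\ell_1+\dots+\ell_i\ge k_i$. A game on this multiset is a weighted majority game if there exist nonnegative weights $w_1,\dots,w_m$ and $q\ge0$ such that $\{1^{\ell_1},\dots,m^{\ell_m}\}$ is winning iff $\sum_i\ell_iw_i\ge q$. *)

theory Defs
  imports Complex_Main "HOL-Library.Multiset"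
begin

text \<open>A game on a multiset is its multiset of players together with the set of winning coalitions,
  the coalitions being the submultisets of the players.\<close>

record 'a mgame =
  players :: "'a multiset"
  winning :: "'a multiset set"

definition simple_game :: "'a mgame \<Rightarrow> bool" where
  "simple_game G \<longleftrightarrow>
     (\<forall>X \<in> winning G. X \<subseteq># players G) \<and>
     (\<forall>X \<in> winning G. \<forall>Y. X \<subseteq># Y \<longrightarrow> Y \<subseteq># players G \<longrightarrow> Y \<in> winning G)"

definition weighted_majority_game :: "'a mgame \<Rightarrow> bool" where
  "weighted_majority_game G \<longleftrightarrow>
     (\<exists>(w :: 'a \<Rightarrow> real) (q :: real).
        (\<forall>i \<in># players G. w i \<ge> 0) \<and> q \<ge> 0 \<and>
        (\<forall>X. X \<subseteq># players G \<longrightarrow>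
           (X \<in> winning G \<longleftrightarrow> (\<Sum>i\<in>set_mset (players G). real (count X i) * w i) \<ge> q)))"

text \<open>The vectors \<open>(n\<^sub>1, \<dots>, n\<^sub>m)\<close> and \<open>(k\<^sub>1, \<dots>, k\<^sub>m)\<close> are represented by functions on \<open>nat\<close> of
  which only the values on \<open>{1..m}\<close> are used. Dropping the last level is thus replacing \<open>m\<close> by
  \<open>m - 1\<close>.\<close>

definition level_mset :: "nat \<Rightarrow> (nat \<Rightarrow> nat) \<Rightarrow> nat multiset" where
  "level_mset m n = (\<Sum>i=1..m. replicate_mset (n i) i)"

definition disj_hier_game :: "nat \<Rightarrow> (nat \<Rightarrow> nat) \<Rightarrow> (nat \<Rightarrow> nat) \<Rightarrow> nat mgame" where
  "disj_hier_game m n k =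
     \<lparr>players = level_mset m n,
      winning = {X. X \<subseteq># level_mset m n \<and> (\<exists>i\<in>{1..m}. (\<Sum>j=1..i. count X j) \<ge> k i)}\<rparr>"

lemma count_level_mset: "count (level_mset m n) i = (if i \<in> {1..m} then n i else 0)"
  by (simp add: level_mset_def count_sum)

lemma simple_game_disj_hier_game: "simple_game (disj_hier_game m n k)"
proof -
  have "(\<Sum>j=1..i. count X j) \<le> (\<Sum>j=1..i. count Y j)" if "X \<subseteq># Y" for X Y :: "nat multiset" and i
    using that by (intro sum_mono mset_subset_eq_count)
  then show ?thesis
    unfolding simple_game_def disj_hier_game_def
    by simp (meson order_trans)
qed

text \<open>The subtractions on \<open>nat\<close> are only used for increasing thresholds, where they do not
  truncate. In the case \<open>m = 3\<close> the first level is dropped, and the remaining two-level game, with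
  parameters \<open>(n\<^sub>2, n\<^sub>3)\<close> and \<open>(k\<^sub>2, k\<^sub>3)\<close>, has to satisfy one of the two two-level conditions
  above it.\<close>

definition weighted_cond :: "nat \<Rightarrow> (nat \<Rightarrow> nat) \<Rightarrow> (nat \<Rightarrow> nat) \<Rightarrow> bool" where
  "weighted_cond m n k \<longleftrightarrow>
     m = 1 \<or>
     (m = 2 \<and> k 2 = k 1 + 1) \<or>
     (m = 2 \<and> n 2 = k 2 - k 1 + 1) \<or>
     (k 1 = 1 \<and> (m = 2 \<or> (m = 3 \<and> (k 3 = k 2 + 1 \<or> n 3 = k 3 - k 2 + 1))))"

end

theory Submission
  imports Defs
begin

text \<open>A level with \<open>k m = k (m - 1) + n m\<close> consists of dummies and may be given weight 0, so suppose
  that there is none. If \<open>k 1 = 1\<close>, a player of level 1 wins alone and may be given the quota as weight,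
  which reduces the problem to the levels from 2 on, where now \<open>k 2 \<ge> 2\<close>.

  Necessity is by trading: in a weighted game two winning coalitions cannot have the same multiset
  union as two losing ones. Let \<open>a\<close> be the lowest level with \<open>k a \<ge> 2\<close>, write \<open>d = k (a+1) - k a\<close> and
  \<open>e = k (a+2) - k (a+1)\<close>, and list coalitions by their levels from \<open>a\<close> on. If level \<open>a + 2\<close> exists, the
  winning \<open>(k a, 0, 0)\<close> and \<open>(k a - 2, d + 1, e + 1)\<close> can be traded into the losing \<open>(k a - 1, d, e)\<close>
  and \<open>(k a - 1, 1, 1)\<close>. If it does not, but \<open>d \<ge> 2\<close> and level \<open>a + 1\<close> has at least \<open>d + 2\<close> players, then
  the winning \<open>(k a, 0)\<close> and \<open>(k a - 2, d + 2)\<close> can be traded into the losing \<open>(k a - 1, d)\<close> and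
  \<open>(k a - 1, 2)\<close>.\<close>

section \<open>Coalitions as vectors of level sizes\<close>

text \<open>A coalition is determined by its counts \<open>l i\<close>. Positivity of
  \<open>n\<close> makes every level in \<open>{1..m}\<close> occur among the players, so the weight
  sum over the players is the sum over \<open>{1..m}\<close>.\<close>

lemma weighted_disj_hier_game_iff:
  assumes n: "\<And>i. i \<in> {1..m} \<Longrightarrow> n i > 0"
  shows "weighted_majority_game (disj_hier_game m n k) \<longleftrightarrow>
    (\<exists>(w :: nat \<Rightarrow> real) q. (\<forall>i\<in>{1..m}. 0 \<le> w i) \<and> 0 \<le> q \<and>
       (\<forall>l. (\<forall>i\<in>{1..m}. l i \<le> n i) \<longrightarrow>
         ((\<exists>i\<in>{1..m}. k i \<le> (\<Sum>j=1..i. l j)) \<longleftrightarrow> q \<le> (\<Sum>i=1..m. real (l i) * w i))))"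
    (is "_ \<longleftrightarrow> (\<exists>w q. ?A w \<and> 0 \<le> q \<and> ?L w q)")
proof -
  have players: "set_mset (level_mset m n) = {1..m}"
    using n by (auto simp: count_level_mset simp flip: count_greater_zero_iff split: if_splits)
  have "(\<forall>X. X \<subseteq># level_mset m n \<longrightarrow>
           (X \<in> winning (disj_hier_game m n k) \<longleftrightarrow> q \<le> (\<Sum>i=1..m. real (count X i) * w i)))
        \<longleftrightarrow> ?L w q" (is "?M \<longleftrightarrow> _") for w q
  proof
    assume M: ?M
    show "?L w q"
    proof (intro allI impI)
      fix l :: "nat \<Rightarrow> nat"
      assume l: "\<forall>i\<in>{1..m}. l i \<le> n i"
      define X where "X = level_mset m l"
      have X: "X \<subseteq># level_mset m n"
        using l by (auto simp: X_def subseteq_mset_def count_level_mset)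
      have "(\<Sum>j=1..i. count X j) = (\<Sum>j=1..i. l j)" if "i \<in> {1..m}" for i
        using that by (intro sum.cong) (auto simp: X_def count_level_mset)
      then have "(\<exists>i\<in>{1..m}. k i \<le> (\<Sum>j=1..i. count X j)) \<longleftrightarrow>
          (\<exists>i\<in>{1..m}. k i \<le> (\<Sum>j=1..i. l j))"
        by (intro bex_cong refl) simp
      moreover have "(\<Sum>i=1..m. real (count X i) * w i) = (\<Sum>i=1..m. real (l i) * w i)"
        by (intro sum.cong) (auto simp: X_def count_level_mset)
      ultimately show "(\<exists>i\<in>{1..m}. k i \<le> (\<Sum>j=1..i. l j)) \<longleftrightarrow> q \<le> (\<Sum>i=1..m. real (l i) * w i)"
        using M X by (simp add: disj_hier_game_def)
    qed
  next
    assume L: "?L w q"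
    show ?M
    proof (intro allI impI)
      fix X
      assume X: "X \<subseteq># level_mset m n"
      then have "\<forall>i\<in>{1..m}. count X i \<le> n i"
        by (metis count_level_mset mset_subset_eq_count)
      with L have "(\<exists>i\<in>{1..m}. k i \<le> (\<Sum>j=1..i. count X j)) \<longleftrightarrow>
          q \<le> (\<Sum>i=1..m. real (count X i) * w i)"
        by blast
      with X show "X \<in> winning (disj_hier_game m n k) \<longleftrightarrow>
          q \<le> (\<Sum>i=1..m. real (count X i) * w i)"
        by (simp add: disj_hier_game_def)
    qed
  qed
  then show ?thesis
    unfolding weighted_majority_game_def
    by (simp add: disj_hier_game_def players)
qed

text \<open>The explicit constructions below all use natural weights, for which nonnegativity is
  automatic.\<close>

lemma weighted_disj_hier_gameI:
  fixes w :: "nat \<Rightarrow> nat" and q :: nat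
  assumes "\<And>i. i \<in> {1..m} \<Longrightarrow> n i > 0"
    and "\<And>l. \<forall>i\<in>{1..m}. l i \<le> n i \<Longrightarrow>
      (\<exists>i\<in>{1..m}. k i \<le> (\<Sum>j=1..i. l j)) \<longleftrightarrow> q \<le> (\<Sum>i=1..m. l i * w i)"
  shows "weighted_majority_game (disj_hier_game m n k)"
proof -
  have "real q \<le> (\<Sum>i=1..m. real (l i) * real (w i)) \<longleftrightarrow> q \<le> (\<Sum>i=1..m. l i * w i)"
    for l :: "nat \<Rightarrow> nat"
    by (simp flip: of_nat_mult of_nat_sum)
  with assms show ?thesis
    by (subst weighted_disj_hier_game_iff)
      (auto intro!: exI[of _ "\<lambda>i. real (w i)"] exI[of _ "real q"])
qed

section \<open>Explicit weights for the listed cases\<close>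

text \<open>The weight equals \<open>(a + b) * K + a\<close>. Any \<open>K + 1\<close> players reach
  \<open>(K + 1) * K\<close>; with at most \<open>K\<close> players the weight is at most
  \<open>K * K + a\<close>, which suffices only if \<open>a\<close> is at least
  \<open>K\<close>.\<close>

lemma consecutive_thresholds_weights:
  fixes K a b :: nat
  shows "K \<le> a \<or> K + 1 \<le> a + b \<longleftrightarrow> K * (K + 1) \<le> a * (K + 1) + b * K"
proof (cases "K \<le> a")
  case True
  then have "K * (K + 1) \<le> a * (K + 1)"
    by (rule mult_le_mono1)
  with True show ?thesis
    by linarith
next
  case False
  have eq: "a * (K + 1) + b * K = (a + b) * K + a"
    by (simp add: algebra_simps)
  show ?thesis
  proof (cases "K + 1 \<le> a + b")
    case True
    then have "(K + 1) * K \<le> (a + b) * K"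
      by (rule mult_le_mono1)
    then have "K * (K + 1) \<le> (a + b) * K + a"
      by (simp add: mult.commute)
    with True eq show ?thesis
      by auto
  next
    case less: False
    then have "(a + b) * K \<le> K * K"
      by (intro mult_le_mono1) simp
    moreover have "K * (K + 1) = K * K + K"
      by simp
    ultimately have "(a + b) * K + a < K * (K + 1)"
      using False by linarith
    with False less eq show ?thesis
      by auto
  qed
qed

text \<open>With \<open>a = K - 1\<close> the deficit is \<open>d + 1\<close>, which
  \<open>b\<close> must cover alone; this is also the count condition. With smaller \<open>a\<close>
  the deficit is at least \<open>2 * (d + 1)\<close>, out of reach for \<open>b\<close>, and the
  count condition fails too.\<close>

lemma short_level_weights:
  fixes K d a b :: nat
  assumes "b \<le> d + 1"
  shows "K \<le> a \<or> K + d \<le> a + b \<longleftrightarrow> K * (d + 1) \<le> a * (d + 1) + b"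
proof -
  consider "K \<le> a" | "K = a + 1" | "a + 2 \<le> K"
    by linarith
  then show ?thesis
  proof cases
    case 1
    then have "K * (d + 1) \<le> a * (d + 1)"
      by (rule mult_le_mono1)
    with 1 show ?thesis
      by linarith
  next
    case 2
    then show ?thesis
      by auto
  next
    case 3
    then have "(a + 2) * (d + 1) \<le> K * (d + 1)"
      by (rule mult_le_mono1)
    with 3 assms show ?thesis
      by auto
  qed
qed

lemma passer_weights:
  fixes c q s :: nat
  shows "1 \<le> c \<or> q \<le> s \<longleftrightarrow> q \<le> c * q + s"
  by (cases c) auto

lemma weighted_disj_hier_game_two:
  fixes q x y :: nat
  assumes n: "\<And>i. i \<in> {1..2} \<Longrightarrow> n i > 0"
    and "\<And>a b. a \<le> n 1 \<Longrightarrow> b \<le> n 2 \<Longrightarrow> (k 1 \<le> a \<or> k 2 \<le> a + b) \<longleftrightarrow> q \<le> a * x + b * y"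
  shows "weighted_majority_game (disj_hier_game 2 n k)"
proof (rule weighted_disj_hier_gameI)
  fix l :: "nat \<Rightarrow> nat"
  assume "\<forall>i\<in>{1..2}. l i \<le> n i"
  moreover have "{1..2} = {1, 2 :: nat}"
    by auto
  ultimately show "(\<exists>i\<in>{1..2}. k i \<le> (\<Sum>j=1..i. l j)) \<longleftrightarrow>
      q \<le> (\<Sum>i=1..2. l i * (if i = 1 then x else y))"
    using assms(2)[of "l 1" "l 2"]
    by auto
qed (use n in auto)

text \<open>A player of level 1 weighs the whole quota. Without such players, only the two-level
  game on levels 2 and 3 remains.\<close>

lemma weighted_disj_hier_game_three:
  fixes q x y :: nat
  assumes n: "\<And>i. i \<in> {1..3} \<Longrightarrow> n i > 0"
    and k: "k 1 = 1"
    and "\<And>a b. a \<le> n 2 \<Longrightarrow> b \<le> n 3 \<Longrightarrow> (k 2 \<le> a \<or> k 3 \<le> a + b) \<longleftrightarrow> q \<le> a * x + b * y"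
  shows "weighted_majority_game (disj_hier_game 3 n k)"
proof (rule weighted_disj_hier_gameI)
  fix l :: "nat \<Rightarrow> nat"
  assume "\<forall>i\<in>{1..3}. l i \<le> n i"
  moreover have "{1..3} = {1, 2, 3 :: nat}" "{1..2} = {1, 2 :: nat}"
    by auto
  ultimately show "(\<exists>i\<in>{1..3}. k i \<le> (\<Sum>j=1..i. l j)) \<longleftrightarrow>
      q \<le> (\<Sum>i=1..3. l i * (if i = 1 then q else if i = 2 then x else y))"
    using assms(3)[of "l 2" "l 3"] passer_weights[of "l 1" q "l 2 * x + l 3 * y"] k
    by (cases "l 1 = 0") (auto simp: add_ac)
qed (use n in auto)

lemma weighted_if_weighted_cond:
  assumes m: "weighted_cond m n k"
    and n: "\<And>i. i \<in> {1..m} \<Longrightarrow> n i > 0"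
    and k: "strict_mono_on {1..m} k"
  shows "weighted_majority_game (disj_hier_game m n k)"
proof -
  have less: "k 1 < k 2" if "m \<ge> 2"
    using k that by (auto simp: strict_mono_on_def)
  have less': "k 2 < k 3" if "m \<ge> 3"
    using k that by (auto simp: strict_mono_on_def)
  consider "m = 1" | "m = 2" "k 2 = k 1 + 1" | "m = 2" "n 2 = k 2 - k 1 + 1" | "m = 2" "k 1 = 1"
    | "m = 3" "k 1 = 1" "k 3 = k 2 + 1" | "m = 3" "k 1 = 1" "n 3 = k 3 - k 2 + 1"
    using m by (auto simp: weighted_cond_def)
  then show ?thesis
  proof cases
    case 1
    show ?thesis
      using n by (rule weighted_disj_hier_gameI[where w = "\<lambda>_. 1" and q = "k 1"]) (auto simp: 1)
  next
    case 2
    show ?thesis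
      unfolding 2(1)
    proof (rule weighted_disj_hier_game_two)
      show "(k 1 \<le> a \<or> k 2 \<le> a + b) \<longleftrightarrow> k 1 * (k 1 + 1) \<le> a * (k 1 + 1) + b * k 1" for a b
        unfolding 2(2) by (rule consecutive_thresholds_weights)
    qed (use n 2 in auto)
  next
    case 3
    show ?thesis
      unfolding 3(1)
    proof (rule weighted_disj_hier_game_two)
      show "(k 1 \<le> a \<or> k 2 \<le> a + b) \<longleftrightarrow> k 1 * (k 2 - k 1 + 1) \<le> a * (k 2 - k 1 + 1) + b * 1"
        if "b \<le> n 2" for a b
        using short_level_weights[of b "k 2 - k 1" "k 1" a] that 3 less by simp
    qed (use n 3 in auto)
  next
    case 4
    show ?thesis
      unfolding 4(1)
    proof (rule weighted_disj_hier_game_two)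
      \<comment> \<open>Since \<open>k 1 = 1\<close>, level 1 gets the quota \<open>k 2\<close> as
        weight and level 2 gets weight 1.\<close>
      show "(k 1 \<le> a \<or> k 2 \<le> a + b) \<longleftrightarrow> k 2 \<le> a * k 2 + b * 1" for a b
        using 4 by (cases a) auto
    qed (use n 4 in auto)
  next
    case 5
    show ?thesis
      unfolding 5(1)
    proof (rule weighted_disj_hier_game_three)
      show "(k 2 \<le> a \<or> k 3 \<le> a + b) \<longleftrightarrow> k 2 * (k 2 + 1) \<le> a * (k 2 + 1) + b * k 2" for a b
        unfolding 5(3) by (rule consecutive_thresholds_weights)
    qed (use n 5 in auto)
  next
    case 6
    show ?thesis
      unfolding 6(1)
    proof (rule weighted_disj_hier_game_three)
      show "(k 2 \<le> a \<or> k 3 \<le> a + b) \<longleftrightarrow> k 2 * (k 3 - k 2 + 1) \<le> a * (k 3 - k 2 + 1) + b * 1"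
        if "b \<le> n 3" for a b
        using short_level_weights[of b "k 3 - k 2" "k 2" a] that 6 less' by simp
    qed (use n 6 in auto)
  qed
qed

section \<open>Adding and removing the last level\<close>

text \<open>A coalition reaching \<open>k (Suc m)\<close> still has at least
  \<open>k (Suc m) - n (Suc m)\<close> players in the first \<open>m\<close> levels, hence reaches
  \<open>k m\<close> already. So weight 0 works for the new level.\<close>

lemma weighted_add_dummies:
  assumes n: "\<And>i. i \<in> {1..Suc m} \<Longrightarrow> n i > 0"
    and m: "m \<ge> 1"
    and k: "k m + n (Suc m) \<le> k (Suc m)"
    and weighted: "weighted_majority_game (disj_hier_game m n k)"
  shows "weighted_majority_game (disj_hier_game (Suc m) n k)"
proof -
  obtain w :: "nat \<Rightarrow> real" and q where w: "\<forall>i\<in>{1..m}. 0 \<le> w i" and q: "0 \<le> q"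
    and iff: "\<And>l. \<forall>i\<in>{1..m}. l i \<le> n i \<Longrightarrow>
      (\<exists>i\<in>{1..m}. k i \<le> (\<Sum>j=1..i. l j)) \<longleftrightarrow> q \<le> (\<Sum>i=1..m. real (l i) * w i)"
    using weighted n by (subst (asm) weighted_disj_hier_game_iff) auto
  have main: "(\<exists>i\<in>{1..Suc m}. k i \<le> (\<Sum>j=1..i. l j)) \<longleftrightarrow>
      q \<le> (\<Sum>i=1..Suc m. real (l i) * (w(Suc m := 0)) i)"
    if l: "\<forall>i\<in>{1..Suc m}. l i \<le> n i" for l
  proof -
    have "l (Suc m) \<le> n (Suc m)"
      using l by auto
    with k m have "(\<exists>i\<in>{1..Suc m}. k i \<le> (\<Sum>j=1..i. l j)) \<longleftrightarrow> (\<exists>i\<in>{1..m}. k i \<le> (\<Sum>j=1..i. l j))"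
      by (force simp: atLeastAtMostSuc_conv)
    also have "\<dots> \<longleftrightarrow> q \<le> (\<Sum>i=1..m. real (l i) * w i)"
      using l by (intro iff) auto
    also have "(\<Sum>i=1..m. real (l i) * w i) = (\<Sum>i=1..Suc m. real (l i) * (w(Suc m := 0)) i)"
      by simp
    finally show ?thesis .
  qed
  show ?thesis
    using w q
    by (intro weighted_disj_hier_game_iff[THEN iffD2] n exI[of _ "w(Suc m := 0)"] exI[of _ q]
        conjI allI impI main) auto
qed

text \<open>The same weights and quota work: for coalitions without players of the last level,
  reaching \<open>k (Suc m)\<close> implies reaching \<open>k m\<close>.\<close>

lemma weighted_drop_last_level:
  assumes n: "\<And>i. i \<in> {1..Suc m} \<Longrightarrow> n i > 0"
    and m: "m \<ge> 1"
    and k: "k m \<le> k (Suc m)"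
    and weighted: "weighted_majority_game (disj_hier_game (Suc m) n k)"
  shows "weighted_majority_game (disj_hier_game m n k)"
proof -
  obtain w :: "nat \<Rightarrow> real" and q where w: "\<forall>i\<in>{1..Suc m}. 0 \<le> w i" and q: "0 \<le> q"
    and iff: "\<And>l. \<forall>i\<in>{1..Suc m}. l i \<le> n i \<Longrightarrow>
      (\<exists>i\<in>{1..Suc m}. k i \<le> (\<Sum>j=1..i. l j)) \<longleftrightarrow> q \<le> (\<Sum>i=1..Suc m. real (l i) * w i)"
    using weighted n by (subst (asm) weighted_disj_hier_game_iff) auto
  have n': "n i > 0" if "i \<in> {1..m}" for i
    using n that by auto
  have main: "(\<exists>i\<in>{1..m}. k i \<le> (\<Sum>j=1..i. l j)) \<longleftrightarrow> q \<le> (\<Sum>i=1..m. real (l i) * w i)"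
    if l: "\<forall>i\<in>{1..m}. l i \<le> n i" for l
  proof -
    define l' where "l' = l(Suc m := 0)"
    have sum: "(\<Sum>j=1..i. l' j) = (\<Sum>j=1..i. l j)" if "i \<le> m" for i
      using that by (intro sum.cong) (auto simp: l'_def)
    have "(\<exists>i\<in>{1..Suc m}. k i \<le> (\<Sum>j=1..i. l' j)) \<longleftrightarrow> (\<exists>i\<in>{1..m}. k i \<le> (\<Sum>j=1..i. l' j))"
      using k m by (force simp: atLeastAtMostSuc_conv l'_def)
    also have "\<dots> \<longleftrightarrow> (\<exists>i\<in>{1..m}. k i \<le> (\<Sum>j=1..i. l j))"
      using sum by auto
    finally have "(\<exists>i\<in>{1..m}. k i \<le> (\<Sum>j=1..i. l j)) \<longleftrightarrow>
        q \<le> (\<Sum>i=1..Suc m. real (l' i) * w i)"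
      using l by (subst iff[symmetric]) (auto simp: l'_def)
    also have "(\<Sum>i=1..Suc m. real (l' i) * w i) = (\<Sum>i=1..m. real (l i) * w i)"
      by (simp add: l'_def)
    finally show ?thesis .
  qed
  show ?thesis
    using w q
    by (intro weighted_disj_hier_game_iff[THEN iffD2] n' exI[of _ w] exI[of _ q]
        conjI allI impI main) auto
qed

section \<open>Necessity by trading\<close>

text \<open>Both pairs have the same total weight, at least \<open>2 * q\<close>. As
  \<open>y\<close> weighs less than \<open>q\<close>, \<open>y'\<close> must weigh more.\<close>

lemma weighted_trade:
  fixes x x' y y' :: "nat \<Rightarrow> nat"
  assumes n: "\<And>i. i \<in> {1..m} \<Longrightarrow> n i > 0"
    and weighted: "weighted_majority_game (disj_hier_game m n k)"
    and le: "\<And>i. i \<in> {1..m} \<Longrightarrow> x i \<le> n i \<and> x' i \<le> n i \<and> y i \<le> n i \<and> y' i \<le> n i"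
    and eq: "\<And>i. i \<in> {1..m} \<Longrightarrow> x i + x' i = y i + y' i"
    and x: "\<exists>i\<in>{1..m}. k i \<le> (\<Sum>j=1..i. x j)"
    and x': "\<exists>i\<in>{1..m}. k i \<le> (\<Sum>j=1..i. x' j)"
    and y: "\<not> (\<exists>i\<in>{1..m}. k i \<le> (\<Sum>j=1..i. y j))"
  shows "\<exists>i\<in>{1..m}. k i \<le> (\<Sum>j=1..i. y' j)"
proof -
  obtain w :: "nat \<Rightarrow> real" and q where
    iff: "\<And>l. \<forall>i\<in>{1..m}. l i \<le> n i \<Longrightarrow>
      (\<exists>i\<in>{1..m}. k i \<le> (\<Sum>j=1..i. l j)) \<longleftrightarrow> q \<le> (\<Sum>i=1..m. real (l i) * w i)"
    using weighted n by (subst (asm) weighted_disj_hier_game_iff) auto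
  have "(\<Sum>i=1..m. real (x i) * w i) + (\<Sum>i=1..m. real (x' i) * w i)
      = (\<Sum>i=1..m. real (x i + x' i) * w i)"
    by (simp add: sum.distrib algebra_simps)
  also have "\<dots> = (\<Sum>i=1..m. real (y i + y' i) * w i)"
    using eq by (intro sum.cong) auto
  also have "\<dots> = (\<Sum>i=1..m. real (y i) * w i) + (\<Sum>i=1..m. real (y' i) * w i)"
    by (simp add: sum.distrib algebra_simps)
  finally have "(\<Sum>i=1..m. real (x i) * w i) + (\<Sum>i=1..m. real (x' i) * w i)
      = (\<Sum>i=1..m. real (y i) * w i) + (\<Sum>i=1..m. real (y' i) * w i)" .
  moreover have "q \<le> (\<Sum>i=1..m. real (x i) * w i)" "q \<le> (\<Sum>i=1..m. real (x' i) * w i)"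
    "\<not> q \<le> (\<Sum>i=1..m. real (y i) * w i)"
    using iff[of x] iff[of x'] iff[of y] le x x' y by auto
  ultimately have "q \<le> (\<Sum>i=1..m. real (y' i) * w i)"
    by linarith
  with iff[of y'] le show ?thesis
    by auto
qed

text \<open>A sum of three indicator terms instead of nested conditionals, so that prefix sums split
  by linearity.\<close>

definition three_levels :: "nat \<Rightarrow> nat \<Rightarrow> nat \<Rightarrow> nat \<Rightarrow> nat \<Rightarrow> nat" where
  "three_levels a r s t =
     (\<lambda>j. (if j = a then r else 0) + (if j = a + 1 then s else 0) + (if j = a + 2 then t else 0))"

lemma sum_three_levels:
  assumes "a \<ge> 1"
  shows "(\<Sum>j=1..i. three_levels a r s t j) =
    (if a \<le> i then r else 0) + (if a + 1 \<le> i then s else 0) + (if a + 2 \<le> i then t else 0)"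
  using assms by (simp add: three_levels_def sum.distrib)

lemma three_levels_winning:
  assumes "a \<ge> 1" "i \<in> {1..m}"
    and "k i \<le> (if a \<le> i then r else 0) + (if a + 1 \<le> i then s else 0) +
      (if a + 2 \<le> i then t else 0)"
  shows "\<exists>i\<in>{1..m}. k i \<le> (\<Sum>j=1..i. three_levels a r s t j)"
  using assms sum_three_levels by metis

text \<open>Below level \<open>a\<close> the prefix sums are 0, and from level \<open>a + 2\<close>
  on they are constant while the thresholds grow, so three comparisons are enough.\<close>

lemma three_levels_losing:
  assumes k: "strict_mono_on {1..m} k"
    and pos: "\<And>i. i \<in> {1..m} \<Longrightarrow> k i > 0"
    and a: "a \<ge> 1"
    and "r < k a" "r + s < k (a + 1)" "a + 2 \<le> m \<Longrightarrow> r + s + t < k (a + 2)"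
  shows "\<not> (\<exists>i\<in>{1..m}. k i \<le> (\<Sum>j=1..i. three_levels a r s t j))"
proof -
  have "(\<Sum>j=1..i. three_levels a r s t j) < k i" if i: "i \<in> {1..m}" for i
  proof -
    have "k (a + 2) \<le> k i" if "a + 2 \<le> i"
      using strict_mono_on_leD[OF k, of "a + 2" i] that i by auto
    then have "r + s + t < k i" if "a + 2 \<le> i"
      using assms(6) i that by force
    moreover have "i < a \<or> i = a \<or> i = a + 1 \<or> a + 2 \<le> i"
      by linarith
    ultimately show ?thesis
      unfolding sum_three_levels[OF a] using pos[OF i] assms(4,5) by (elim disjE) simp_all
  qed
  then show ?thesis
    by (simp add: not_le)
qed

text \<open>The bounds make the traded coalitions available: \<open>2 \<le> k a\<close> allows
  removing two players of level \<open>a\<close>, while \<open>k1\<close> and \<open>k2\<close>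
  provide \<open>d + 1\<close> and \<open>e + 1\<close> players of the next levels.\<close>

lemma weighted_levels_above:
  assumes n: "\<And>i. i \<in> {1..m} \<Longrightarrow> n i > 0"
    and pos: "\<And>i. i \<in> {1..m} \<Longrightarrow> k i > 0"
    and k: "strict_mono_on {1..m} k"
    and weighted: "weighted_majority_game (disj_hier_game m n k)"
    and a: "1 \<le> a" "a + 1 \<le> m"
    and ka: "2 \<le> k a" "k a \<le> n a"
    and k1: "k (a + 1) < k a + n (a + 1)"
    and k2: "a + 2 \<le> m \<Longrightarrow> k (a + 2) < k (a + 1) + n (a + 2)"
  shows "m = a + 1 \<and> (k (a + 1) = k a + 1 \<or> n (a + 1) = k (a + 1) - k a + 1)"
proof -
  define d where "d = k (a + 1) - k a"
  have "k a < k (a + 1)"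
    using k a by (auto simp: strict_mono_on_def)
  then have d: "k (a + 1) = k a + d" "d \<ge> 1"
    by (auto simp: d_def)
  have first: "\<exists>i\<in>{1..m}. k i \<le> (\<Sum>j=1..i. three_levels a (k a) 0 0 j)"
    using a by (intro three_levels_winning[of a a]) auto
  have m: "m = a + 1"
  proof (rule ccontr)
    assume "m \<noteq> a + 1"
    with a have m: "a + 2 \<le> m"
      by linarith
    define e where "e = k (a + 2) - k (a + 1)"
    have "k (a + 1) < k (a + 2)"
      using k a m by (auto simp: strict_mono_on_def)
    then have e: "k (a + 2) = k a + d + e" "e \<ge> 1"
      using d by (auto simp: e_def)
    have "\<exists>i\<in>{1..m}. k i \<le> (\<Sum>j=1..i. three_levels a (k a - 1) 1 1 j)"
    proof (rule weighted_trade[where x = "three_levels a (k a) 0 0", OF n weighted])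
      show "\<exists>i\<in>{1..m}. k i \<le> (\<Sum>j=1..i. three_levels a (k a) 0 0 j)"
        by (fact first)
      \<comment> \<open>The total is \<open>k a + d + e\<close>, exactly the threshold of level
        \<open>a + 2\<close>.\<close>
      show "\<exists>i\<in>{1..m}. k i \<le> (\<Sum>j=1..i. three_levels a (k a - 2) (d + 1) (e + 1) j)"
        using a m e ka by (intro three_levels_winning[of a "a + 2"]) auto
      \<comment> \<open>Each of the three prefix sums is one short of its threshold.\<close>
      show "\<not> (\<exists>i\<in>{1..m}. k i \<le> (\<Sum>j=1..i. three_levels a (k a - 1) d e j))"
        using a d e ka by (intro three_levels_losing[OF k pos]) auto
    qed (use k1 k2 m d e ka in \<open>auto simp: three_levels_def\<close>)
    \<comment> \<open>The prefix sums \<open>k a - 1\<close>, \<open>k a\<close>,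
      \<open>k a + 1\<close> stay below \<open>k a\<close>, \<open>k a + d\<close>,
      \<open>k a + d + e\<close> since \<open>d\<close> and \<open>e\<close> are positive.\<close>
    moreover have "\<not> (\<exists>i\<in>{1..m}. k i \<le> (\<Sum>j=1..i. three_levels a (k a - 1) 1 1 j))"
      using a d e ka by (intro three_levels_losing[OF k pos]) auto
    ultimately show False
      by contradiction
  qed
  have "d = 1 \<or> n (a + 1) = d + 1"
  proof (rule ccontr)
    assume "\<not> (d = 1 \<or> n (a + 1) = d + 1)"
    \<comment> \<open>\<open>k1\<close> gives only \<open>d + 1\<close> players of level
      \<open>a + 1\<close>; excluding equality yields the one more that the trade needs.\<close>
    with d k1 have d': "d \<ge> 2" "n (a + 1) \<ge> d + 2"
      by auto
    have "\<exists>i\<in>{1..m}. k i \<le> (\<Sum>j=1..i. three_levels a (k a - 1) 2 0 j)"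
    proof (rule weighted_trade[where x = "three_levels a (k a) 0 0", OF n weighted])
      show "\<exists>i\<in>{1..m}. k i \<le> (\<Sum>j=1..i. three_levels a (k a) 0 0 j)"
        by (fact first)
      show "\<exists>i\<in>{1..m}. k i \<le> (\<Sum>j=1..i. three_levels a (k a - 2) (d + 2) 0 j)"
        using a m d ka by (intro three_levels_winning[of a "a + 1"]) auto
      show "\<not> (\<exists>i\<in>{1..m}. k i \<le> (\<Sum>j=1..i. three_levels a (k a - 1) d 0 j))"
        using a d ka m by (intro three_levels_losing[OF k pos]) auto
    qed (use k1 m d' ka in \<open>auto simp: three_levels_def\<close>)
    moreover have "\<not> (\<exists>i\<in>{1..m}. k i \<le> (\<Sum>j=1..i. three_levels a (k a - 1) 2 0 j))"
      using a d d' ka m by (intro three_levels_losing[OF k pos]) auto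
    ultimately show False
      by contradiction
  qed
  with m d show ?thesis
    by auto
qed

text \<open>Here \<open>step\<close> includes \<open>i = m\<close>, so there are no dummies. The
  trades apply with \<open>a = 1\<close> if \<open>k 1\<close> is at least 2, and otherwise with
  \<open>a = 2\<close> once \<open>m\<close> is at least 3.\<close>

lemma weighted_cond_if_weighted:
  assumes m: "m \<ge> 1"
    and n: "\<And>i. i \<in> {1..m} \<Longrightarrow> n i > 0"
    and pos: "\<And>i. i \<in> {1..m} \<Longrightarrow> k i > 0"
    and k: "strict_mono_on {1..m} k"
    and k1: "k 1 \<le> n 1"
    and step: "\<And>i. 1 < i \<Longrightarrow> i \<le> m \<Longrightarrow> k i < k (i - 1) + n i"
    and weighted: "weighted_majority_game (disj_hier_game m n k)"
  shows "weighted_cond m n k"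
proof -
  have above: "m = a + 1 \<and> (k (a + 1) = k a + 1 \<or> n (a + 1) = k (a + 1) - k a + 1)"
    if "1 \<le> a" "a + 1 \<le> m" "2 \<le> k a" "k a \<le> n a" for a
    using that step[of "a + 1"] step[of "a + 2"]
    by (intro weighted_levels_above[OF n pos k weighted]) auto
  have "k 1 \<ge> 1"
    using pos[of 1] m by auto
  show ?thesis
  proof (cases "k 1 = 1")
    case False
    with \<open>k 1 \<ge> 1\<close> have "2 \<le> k 1"
      by linarith
    with above[of 1] k1 m show ?thesis
      by (cases "m = 1") (auto simp: weighted_cond_def numeral_2_eq_2)
  next
    case True
    show ?thesis
    proof (cases "m \<le> 2")
      case False
      \<comment> \<open>With \<open>k 1 = 1\<close>, \<open>step\<close> at level 2 reads
        \<open>k 2 < 1 + n 2\<close>.\<close>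
      then have "k 1 < k 2" "k 2 \<le> n 2"
        using strict_mono_onD[OF k, of 1 2] step[of 2] True by auto
      with above[of 2] False True show ?thesis
        by (auto simp: weighted_cond_def numeral_3_eq_3 numeral_2_eq_2)
    qed (use True m in \<open>auto simp: weighted_cond_def\<close>)
  qed
qed

theorem theorem7:
  fixes m :: nat and n k :: "nat \<Rightarrow> nat"
  assumes "m \<ge> 1"
    and "\<And>i. i \<in> {1..m} \<Longrightarrow> n i > 0"
    and "\<And>i. i \<in> {1..m} \<Longrightarrow> k i > 0"
    and "strict_mono_on {1..m} k"
    and "k 1 \<le> n 1"
    and "\<And>i. 1 < i \<Longrightarrow> i < m \<Longrightarrow> k i < k (i - 1) + n i"
    and "m > 1 \<Longrightarrow> k m \<le> k (m - 1) + n m"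
  shows "weighted_majority_game (disj_hier_game m n k) \<longleftrightarrow>
           weighted_cond m n k \<or>
           (m \<in> {2, 3, 4} \<and> k m \<ge> k (m - 1) + n m \<and> weighted_cond (m - 1) n k)"
proof
  assume weighted: "weighted_majority_game (disj_hier_game m n k)"
  show "weighted_cond m n k \<or>
      (m \<in> {2, 3, 4} \<and> k m \<ge> k (m - 1) + n m \<and> weighted_cond (m - 1) n k)"
  proof (cases "m > 1 \<and> k m \<ge> k (m - 1) + n m")
    case True
    define m' where "m' = m - 1"
    with True have m': "m = Suc m'" "m' \<ge> 1"
      by auto
    have mono: "strict_mono_on {1..m'} k"
      using assms(4) by (rule monotone_on_subset) (auto simp: m')
    have "weighted_majority_game (disj_hier_game m' n k)"
      using assms(2) True weighted unfolding m'(1)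
      by (intro weighted_drop_last_level[of m' n k]) (auto simp: m')
    \<comment> \<open>The strict bounds assumed for \<open>i < m\<close> now cover every level above
      the first, so the smaller game has no dummy level.\<close>
    then have "weighted_cond m' n k"
      using assms m' mono by (intro weighted_cond_if_weighted) auto
    \<comment> \<open>\<open>weighted_cond\<close> forces \<open>m'\<close> to be 1, 2 or 3, whence
      the range \<open>{2, 3, 4}\<close> for \<open>m\<close>.\<close>
    with True m' show ?thesis
      by (auto simp: weighted_cond_def)
  next
    case False
    then have "k i < k (i - 1) + n i" if "1 < i" "i \<le> m" for i
      using assms(6)[of i] that by (cases "i = m") auto
    then have "weighted_cond m n k"
      using assms(1-5) weighted by (intro weighted_cond_if_weighted) auto
    then show ?thesis ..
  qed
next
  assume "weighted_cond m n k \<or>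
      (m \<in> {2, 3, 4} \<and> k m \<ge> k (m - 1) + n m \<and> weighted_cond (m - 1) n k)"
  then show "weighted_majority_game (disj_hier_game m n k)"
  proof
    assume "weighted_cond m n k"
    then show ?thesis
      using assms(2,4) by (rule weighted_if_weighted_cond)
  next
    assume *: "m \<in> {2, 3, 4} \<and> k m \<ge> k (m - 1) + n m \<and> weighted_cond (m - 1) n k"
    define m' where "m' = m - 1"
    with * have m': "m = Suc m'" "m' \<ge> 1"
      by auto
    have "strict_mono_on {1..m'} k"
      using assms(4) by (rule monotone_on_subset) (auto simp: m')
    with * assms(2) have "weighted_majority_game (disj_hier_game m' n k)"
      by (intro weighted_if_weighted_cond) (auto simp: m')
    with * assms(2) show ?thesis
      unfolding m'(1) by (intro weighted_add_dummies) (auto simp: m')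
  qed
qed

end
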